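(* Let $f_1,f_2:\mathbb R^+\to\mathbb R^+$ be continuous and strictly increasing with $f_i(x)>0$ for $x>0$, $i=1,2$. Assume that the equation $f_1^{-1}(x)=f_2(x)$ has exactly one positive solution $K>0$, where $f_2(x)>f_1^{-1}(x)$ for $f_1(0)<x<K$ and $f_2(x)<f_1^{-1}(x)$ for $x>K$. Let $h_i:\mathbb R^+\to\mathbb R$ ($i=1,2$) be Lebesgue measurable with $h_i(t)\le t$ and $\lim_{t\to\infty}h_i(t)=\infty$. For $i=1,2$ let $R_i(t,\cdot)$ be left continuous and non-decreasing for any $t$, let $R_i(\cdot,s)$ be locally integrable for any $s$, let $R_i(t,s)=0$ for $s\le h_i(t)$ and $R_i(t,t^+)=1$, and let $r_i$ be a Lebesgue measurable essentially bounded function on $\mathbb R^+$ with $r_i(t)\ge 0$. Let $\varphi,\psi:(-\infty,0]\to\mathbb R$ be continuous bounded functions with $\varphi(t)\ge 0$, $\psi(t)\ge 0$ for $t<0$ and $\varphi(0)>0$, $\psi(0)>0$. Let $G_1,G_2:\mathbb R^+\to\mathbb R^+$ be continuous with $G_i(x)>0$ for $x>0$. Consider the initial value problem (PG) described in the context. Any solution of (PG) with initial functions satisfying $\varphi(t)\ge K$, $\psi(t)\ge f_2(K)$ for all $t\le0$ satisfies $x(t)\ge K$, $y(t)\ge f_2(K)$ for any $t\ge0$, while any solution of (PG) with $\varphi(t)\le K$, $\psi(t)\le f_2(K)$ for all $t\le 0$ satisfies $x(t)\le K$, $y(t)\le f_2(K)$ for any $t\ge 0$.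
   Context: $\mathbb R^+=[0,\infty)$; $u(t^+)$ is the right-side limit of $u$ at $t$. Problem (PG) is the system $$x'(t)=r_1(t)G_1(x(t))\left[\int_{h_1(t)}^t f_1(y(s))\,d_sR_1(t,s)-x(t)\right],\quad y'(t)=r_2(t)G_2(y(t))\left[\int_{h_2(t)}^t f_2(x(s))\,d_sR_2(t,s)-y(t)\right]$$ with the initial conditions $x(t)=\varphi(t)$, $y(t)=\psi(t)$ for $t\le 0$. The integrals are Stieltjes integrals in $s$ over $[h_i(t),t]$ including the endpoint atoms, i.e. with respect to the probability measure on $[h_i(t),t]$ with (left continuous) distribution function $R_i(t,\cdot)$. A solution is a pair $(x,y)$, locally absolutely continuous on $[0,\infty)$, which satisfies the system for almost all $t\ge0$ and the initial conditions for $t\le0$. Convention: $f_1^{-1}$ is the inverse of $f_1$ on its range, $f_1^{-1}(x)=0$ for $0\le x<f_1(0)$, and $f_1^{-1}(x)=+\infty$ for $x$ above the range of $f_1$. *)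

theory Defs
  imports "HOL-Analysis.Analysis"
begin

text \<open>
  Functions with domain \<open>[0,\<infinity>)\<close> or \<open>(-\<infinity>,0]\<close> are total functions on the reals of which only the
  values on that domain are constrained.
\<close>

definition feedback_function :: "(real \<Rightarrow> real) \<Rightarrow> bool" where
  "feedback_function f \<longleftrightarrow>
     continuous_on {0..} f \<and> strict_mono_on {0..} f \<and> (\<forall>x\<ge>0. f x \<ge> 0) \<and> (\<forall>x>0. f x > 0)"

definition gain_function :: "(real \<Rightarrow> real) \<Rightarrow> bool" where
  "gain_function G \<longleftrightarrow>
     continuous_on {0..} G \<and> (\<forall>x\<ge>0. G x \<ge> 0) \<and> (\<forall>x>0. G x > 0)"

definition delay_function :: "(real \<Rightarrow> real) \<Rightarrow> bool" where
  "delay_function h \<longleftrightarrow>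
     h \<in> borel_measurable (lebesgue_on {0..}) \<and> (\<forall>t\<ge>0. h t \<le> t) \<and> filterlim h at_top at_top"

definition rate_function :: "(real \<Rightarrow> real) \<Rightarrow> bool" where
  "rate_function r \<longleftrightarrow>
     r \<in> borel_measurable (lebesgue_on {0..}) \<and>
     (\<exists>C. AE t in lebesgue_on {0..}. \<bar>r t\<bar> \<le> C) \<and> (\<forall>t\<ge>0. r t \<ge> 0)"

definition delay_kernel :: "(real \<Rightarrow> real) \<Rightarrow> (real \<Rightarrow> real \<Rightarrow> real) \<Rightarrow> bool" where
  "delay_kernel h R \<longleftrightarrow>
     (\<forall>t\<ge>0. \<forall>s. continuous (at_left s) (R t)) \<and>
     (\<forall>t\<ge>0. mono (R t)) \<and>
     (\<forall>s. \<forall>T\<ge>0. set_integrable lebesgue {0..T} (\<lambda>t. R t s)) \<and>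
     (\<forall>t\<ge>0. \<forall>s\<le>h t. R t s = 0) \<and>
     (\<forall>t\<ge>0. (R t \<longlongrightarrow> 1) (at_right t))"

definition initial_function :: "(real \<Rightarrow> real) \<Rightarrow> bool" where
  "initial_function \<phi> \<longleftrightarrow>
     continuous_on {..0} \<phi> \<and> bounded (\<phi> ` {..0}) \<and> (\<forall>t<0. \<phi> t \<ge> 0) \<and> \<phi> 0 > 0"

text \<open>
  The inverse of a continuous strictly increasing \<open>f\<close> on \<open>[0,\<infinity>)\<close>, extended by 0 to \<open>[0, f 0)\<close> and
  by \<open>\<infinity>\<close> above the range; the range is an interval starting at \<open>f 0\<close>, so what remains in the last
  case (for nonnegative arguments) lies above it.
\<close>

definition ext_inverse :: "(real \<Rightarrow> real) \<Rightarrow> real \<Rightarrow> ereal" where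
  "ext_inverse f x =
     (if x \<in> f ` {0..} then ereal (the_inv_into {0..} f x)
      else if x < f 0 then 0 else \<infinity>)"

text \<open>
  The integral of \<open>g\<close> over the closed interval \<open>[a,b]\<close> against the measure with
  \<open>\<mu> [c,d) = F d - F c\<close> for left continuous non-decreasing \<open>F\<close>. As \<^const>\<open>interval_measure\<close> expects a
  right continuous function, it is applied to the right limits of \<open>F\<close>, which give the same measure:
  \<open>\<mu> (c,d] = F (d+) - F (c+)\<close>. An atom at \<open>b\<close>, of mass \<open>F (b+) - F b\<close>, is included.
\<close>

definition stieltjes_integral :: "real \<Rightarrow> real \<Rightarrow> (real \<Rightarrow> real) \<Rightarrow> (real \<Rightarrow> real) \<Rightarrow> real" where
  "stieltjes_integral a b g F =
     set_lebesgue_integral (interval_measure (\<lambda>s. Lim (at_right s) F)) {a..b} g"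

text \<open>
  Absolute continuity on a compact interval, with the finite families of non-overlapping
  subintervals given as divisions of their union.
\<close>

definition abs_continuous_on_Icc :: "real \<Rightarrow> real \<Rightarrow> (real \<Rightarrow> real) \<Rightarrow> bool" where
  "abs_continuous_on_Icc a b u \<longleftrightarrow>
     (\<forall>\<epsilon>>0. \<exists>\<delta>>0. \<forall>\<D> S. \<D> division_of S \<and> S \<subseteq> {a..b} \<and> (\<Sum>k\<in>\<D>. Sup k - Inf k) < \<delta> \<longrightarrow>
        (\<Sum>k\<in>\<D>. \<bar>u (Sup k) - u (Inf k)\<bar>) < \<epsilon>)"

definition locally_abs_continuous :: "(real \<Rightarrow> real) \<Rightarrow> bool" where
  "locally_abs_continuous u \<longleftrightarrow> (\<forall>T>0. abs_continuous_on_Icc 0 T u)"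

definition is_solution_PG ::
  "(real \<Rightarrow> real) \<Rightarrow> (real \<Rightarrow> real) \<Rightarrow> (real \<Rightarrow> real) \<Rightarrow> (real \<Rightarrow> real) \<Rightarrow>
   (real \<Rightarrow> real) \<Rightarrow> (real \<Rightarrow> real) \<Rightarrow> (real \<Rightarrow> real) \<Rightarrow> (real \<Rightarrow> real) \<Rightarrow>
   (real \<Rightarrow> real \<Rightarrow> real) \<Rightarrow> (real \<Rightarrow> real \<Rightarrow> real) \<Rightarrow>
   (real \<Rightarrow> real) \<Rightarrow> (real \<Rightarrow> real) \<Rightarrow> (real \<Rightarrow> real) \<Rightarrow> (real \<Rightarrow> real) \<Rightarrow> bool" where
  "is_solution_PG r1 r2 G1 G2 f1 f2 h1 h2 R1 R2 \<phi> \<psi> x y \<longleftrightarrow>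
     locally_abs_continuous x \<and> locally_abs_continuous y \<and>
     (AE t in lebesgue_on {0..}.
        (x has_real_derivative
           r1 t * G1 (x t) * (stieltjes_integral (h1 t) t (\<lambda>s. f1 (y s)) (R1 t) - x t)) (at t) \<and>
        (y has_real_derivative
           r2 t * G2 (y t) * (stieltjes_integral (h2 t) t (\<lambda>s. f2 (x s)) (R2 t) - y t)) (at t)) \<and>
     (\<forall>t\<le>0. x t = \<phi> t \<and> y t = \<psi> t)"

end

theory Submission
  imports Defs
begin

text \<open>
  An absolutely continuous function whose derivative is nonpositive almost everywhere where it exceeds
  \<open>M\<close> cannot cross \<open>M\<close> upwards. Hence on \<open>[0,T]\<close> a bound \<open>y \<le> B\<close> gives \<open>x \<le> f1 B\<close>, as the delayed
  average of \<open>f1 \<circ> y\<close> is at most \<open>f1 B\<close>, and likewise for \<open>y\<close> and for lower bounds. If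
  \<open>m = max K (max x)\<close>, then \<open>y \<le> f2 m\<close> and \<open>x \<le> f1 (f2 m)\<close>; as \<open>f1 (f2 z) < z\<close> for \<open>z > K\<close>, this
  forces \<open>m = K\<close>. Below \<open>K\<close> the inequality is reversed and the argument is dual. Both need solutions
  to stay positive, which follows from \<open>x' \<ge> - C x\<close> up to the first zero.
\<close>

section \<open>Absolutely continuous functions\<close>

lemma abs_continuous_on_Icc_subset:
  assumes "abs_continuous_on_Icc a b u" "{c..d} \<subseteq> {a..b}"
  shows "abs_continuous_on_Icc c d u"
  using assms unfolding abs_continuous_on_Icc_def by (meson order_trans)

lemma abs_continuous_on_Icc_minus:
  "abs_continuous_on_Icc a b (\<lambda>t. - u t) \<longleftrightarrow> abs_continuous_on_Icc a b u"
  unfolding abs_continuous_on_Icc_def by (simp add: abs_minus_commute)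

lemma abs_continuous_on_Icc_imp_continuous_on:
  assumes "abs_continuous_on_Icc a b u"
  shows "continuous_on {a..b} u"
proof (rule uniformly_continuous_imp_continuous, unfold uniformly_continuous_on_def, intro allI impI)
  fix e :: real assume "e > 0"
  then obtain d where "d > 0" and d: "\<And>\<D> S. \<D> division_of S \<Longrightarrow> S \<subseteq> {a..b} \<Longrightarrow>
      (\<Sum>k\<in>\<D>. Sup k - Inf k) < d \<Longrightarrow> (\<Sum>k\<in>\<D>. \<bar>u (Sup k) - u (Inf k)\<bar>) < e"
    using assms unfolding abs_continuous_on_Icc_def by meson
  have *: "\<bar>u t - u s\<bar> < e" if "s \<in> {a..b}" "t \<in> {a..b}" "s \<le> t" "t - s < d" for s t
    using d[of "{{s..t}}" "{s..t}"] that division_of_self[of s t] by simp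
  have "dist (u t) (u s) < e" if "s \<in> {a..b}" "t \<in> {a..b}" "dist t s < d" for s t
    using *[of s t] *[of t s] that by (cases "s \<le> t") (auto simp: dist_real_def)
  with \<open>d > 0\<close> show "\<exists>d>0. \<forall>x\<in>{a..b}. \<forall>x'\<in>{a..b}. dist x' x < d \<longrightarrow> dist (u x') (u x) < e"
    by blast
qed

text \<open>The errors at \<open>v\<close> and \<open>w\<close> are at most
  \<open>e * (t - v)\<close> and \<open>e * (w - t)\<close>; as \<open>t\<close> lies between the
  two points, they add up to \<open>e * (w - v)\<close>.\<close>

lemma derivative_straddle:
  fixes u :: "real \<Rightarrow> real"
  assumes "(u has_real_derivative D) (at t)" "e > 0"
  obtains d where "d > 0"
    "\<And>v w. v \<le> t \<Longrightarrow> t \<le> w \<Longrightarrow> {v, w} \<subseteq> ball t d \<Longrightarrow> (D - e) * (w - v) \<le> u w - u v"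
proof -
  obtain d where "d > 0" and d: "\<And>y. norm (y - t) < d \<Longrightarrow> norm (u y - u t - D * (y - t)) \<le> e * norm (y - t)"
    using assms unfolding has_field_derivative_def has_derivative_at_alt by blast
  have "(D - e) * (w - v) \<le> u w - u v" if "v \<le> t" "t \<le> w" "{v, w} \<subseteq> ball t d" for v w
  proof -
    have "\<bar>u v - u t - D * (v - t)\<bar> \<le> e * (t - v)" "\<bar>u w - u t - D * (w - t)\<bar> \<le> e * (w - t)"
      using d[of v] d[of w] that by (auto simp: dist_real_def)
    then show ?thesis by (simp add: algebra_simps abs_le_iff)
  qed
  with \<open>d > 0\<close> that show thesis by blast
qed

text \<open>
  Sum over a fine tagged division: intervals tagged off \<open>N\<close> are controlled by the derivative, those
  tagged in \<open>N\<close> lie in an open set of small measure and are controlled by absolute continuity.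
\<close>

lemma abs_continuous_increment_ge:
  assumes "a \<le> b" and ac: "abs_continuous_on_Icc a b u" and N: "negligible N"
    and deriv: "\<And>t. t \<in> {a..b} - N \<Longrightarrow> \<exists>D\<ge>c. (u has_real_derivative D) (at t)"
  shows "c * (b - a) \<le> u b - u a"
proof -
  have main: "c * (b - a) \<le> u b - u a + e * (b - a + 2)" if "e > 0" for e
  proof -
    \<comment> \<open>On an interval tagged in \<open>N\<close> the derivative gives no information,
      so there \<open>c - e\<close> times the length is estimated by \<open>m\<close> times the
      length.\<close>
    define m where "m = \<bar>c - e\<bar>"
    obtain d0 where "d0 > 0" and d0: "\<And>\<D> S. \<D> division_of S \<Longrightarrow> S \<subseteq> {a..b} \<Longrightarrow>
      (\<Sum>k\<in>\<D>. Sup k - Inf k) < d0 \<Longrightarrow> (\<Sum>k\<in>\<D>. \<bar>u (Sup k) - u (Inf k)\<bar>) < e"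
      using ac \<open>e > 0\<close> unfolding abs_continuous_on_Icc_def by meson
    \<comment> \<open>Total length below \<open>d0\<close> keeps the variation of \<open>u\<close>
      over the intervals tagged in \<open>N\<close> below \<open>e\<close>; the second bound keeps
      \<open>m\<close> times that length at most \<open>e\<close>, with \<open>m + 1\<close> in
      place of \<open>m\<close> because \<open>m\<close> may be 0.\<close>
    define d where "d = min d0 (e / (m + 1))"
    have "d > 0" "m \<ge> 0" using \<open>d0 > 0\<close> \<open>e > 0\<close> by (auto simp: d_def m_def intro!: divide_pos_pos)
    have md: "m * d \<le> e"
    proof -
      have "m * d \<le> m * (e / (m + 1))" using \<open>m \<ge> 0\<close> by (intro mult_left_mono) (auto simp: d_def)
      also have "\<dots> \<le> e" using \<open>m \<ge> 0\<close> \<open>e > 0\<close> by (simp add: field_simps)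
      finally show ?thesis .
    qed
    obtain U where "open U" "N \<subseteq> U" "U \<in> lmeasurable" and mU: "measure lebesgue U < d"
    proof -
      have Nl: "N \<in> sets lebesgue" using N by (simp add: negligible_imp_sets)
      from sets_lebesgue_outer_open[OF this \<open>d > 0\<close>] obtain U where
        U: "open U" "N \<subseteq> U" "U - N \<in> lmeasurable" "emeasure lebesgue (U - N) < ennreal d" .
      have Nn: "N \<in> null_sets lebesgue" using N by (simp add: negligible_iff_null_sets)
      have Us: "U \<in> sets lebesgue" using \<open>open U\<close> by auto
      then have "emeasure lebesgue U = emeasure lebesgue (U - N)"
        using emeasure_Diff_null_set[OF Nn Us] by simp
      with U have em: "emeasure lebesgue U < ennreal d" by simp
      then have "U \<in> lmeasurable" using Us by (auto simp: fmeasurable_def less_top intro: order.strict_trans)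
      moreover have "measure lebesgue U < d"
        using em \<open>d > 0\<close> calculation by (simp add: emeasure_eq_measure2 ennreal_less_iff)
      ultimately show thesis using U that by blast
    qed
    \<comment> \<open>The gauge is \<open>U\<close> at points of \<open>N\<close>, a straddle ball
      at the other points of \<open>{a..b}\<close>, and unrestricted elsewhere.\<close>
    have "\<exists>\<gamma>. t \<in> \<gamma> \<and> open \<gamma> \<and> (t \<in> N \<longrightarrow> \<gamma> \<subseteq> U) \<and>
       (t \<in> {a..b} - N \<longrightarrow> (\<forall>v w. v \<le> t \<longrightarrow> t \<le> w \<longrightarrow> {v, w} \<subseteq> \<gamma> \<longrightarrow> (c - e) * (w - v) \<le> u w - u v))" for t
    proof (cases "t \<in> {a..b} - N")
      case True
      then obtain D where "D \<ge> c" "(u has_real_derivative D) (at t)" using deriv by blast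
      from derivative_straddle[OF this(2) \<open>e > 0\<close>] obtain r where
        r: "r > 0" "\<And>v w. v \<le> t \<Longrightarrow> t \<le> w \<Longrightarrow> {v, w} \<subseteq> ball t r \<Longrightarrow> (D - e) * (w - v) \<le> u w - u v" by metis
      have "(c - e) * (w - v) \<le> u w - u v" if "v \<le> t" "t \<le> w" "{v, w} \<subseteq> ball t r" for v w
      proof -
        have "(c - e) * (w - v) \<le> (D - e) * (w - v)"
          using \<open>D \<ge> c\<close> that by (intro mult_right_mono) auto
        with r(2)[OF that] show ?thesis by linarith
      qed
      with r(1) True show ?thesis by (intro exI[of _ "ball t r"]) auto
    next
      case False
      show ?thesis
      proof (cases "t \<in> N")
        case True then show ?thesis using False \<open>open U\<close> \<open>N \<subseteq> U\<close> by (intro exI[of _ U]) auto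
      next
        case F: False
        show ?thesis by (rule exI[of _ UNIV]) (use False F in auto)
      qed
    qed
    then obtain \<gamma> where \<gamma>: "\<And>t. t \<in> \<gamma> t" "\<And>t. open (\<gamma> t)" "\<And>t. t \<in> N \<Longrightarrow> \<gamma> t \<subseteq> U"
      "\<And>t v w. t \<in> {a..b} - N \<Longrightarrow> v \<le> t \<Longrightarrow> t \<le> w \<Longrightarrow> {v, w} \<subseteq> \<gamma> t \<Longrightarrow> (c - e) * (w - v) \<le> u w - u v"
      by metis
    from \<gamma>(1,2) have "gauge \<gamma>" by (rule gaugeI)
    then obtain p where p: "p tagged_division_of {a..b}" "\<gamma> fine p"
      by (rule fine_division_exists_real)
    have tag: "\<exists>v w. K = {v..w} \<and> v \<le> t \<and> t \<le> w \<and> a \<le> v \<and> w \<le> b \<and> Sup K = w \<and> Inf K = v \<and> t \<in> {a..b}"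
      if tK: "(t, K) \<in> p" for t K
    proof -
      obtain v w where "K = {v..w}" using tagged_division_ofD(4)[OF p(1) tK] by auto
      moreover have "t \<in> K" "K \<subseteq> {a..b}" using tagged_division_ofD(2,3)[OF p(1) tK] by auto
      ultimately show ?thesis by (intro exI[of _ v] exI[of _ w]) auto
    qed
    \<comment> \<open>Only degenerate intervals can carry several tags, so tags may be dropped from
      a sum of \<open>B\<close> provided \<open>B\<close> vanishes on them. One-point intervals give
      0 by the formula; the empty set needs its own case since its \<open>Sup\<close> and
      \<open>Inf\<close> are unspecified.\<close>
    define B where "B K = (if K = {} then 0 else \<bar>u (Sup K) - u (Inf K)\<bar> + m * (Sup K - Inf K))" for K
    define q where "q = {(t, K) \<in> p. t \<in> N}"
    have "finite p" using p by blast
    have qp: "q \<subseteq> p" by (auto simp: q_def)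
    have q: "q tagged_partial_division_of {a..b}"
      using p(1) qp by (meson tagged_division_of tagged_partial_division_subset tagged_division_of_def)
    have sumB: "(\<Sum>(t, K)\<in>q. B K) \<le> 2 * e"
    proof -
      define \<D> where "\<D> = snd ` q"
      have div: "\<D> division_of \<Union>\<D>" unfolding \<D>_def by (rule partial_division_of_tagged_division[OF q])
      have K: "\<exists>v w. K = {v..w} \<and> v \<le> w \<and> Sup K = w \<and> Inf K = v \<and> K \<subseteq> U" if "K \<in> \<D>" for K
      proof -
        obtain t where t: "(t, K) \<in> p" "t \<in> N" using \<open>K \<in> \<D>\<close> by (auto simp: \<D>_def q_def)
        have "K \<subseteq> U" using fineD[OF p(2) t(1)] \<gamma>(3)[OF t(2)] by blast
        with tag[OF t(1)] show ?thesis by force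
      qed
      have "(\<Sum>k\<in>\<D>. Sup k - Inf k) = (\<Sum>k\<in>\<D>. measure lebesgue k)"
      proof (rule sum.cong)
        fix k assume "k \<in> \<D>"
        then obtain v w where "k = {v..w}" "v \<le> w" using K by blast
        then show "Sup k - Inf k = measure lebesgue k" by simp
      qed simp
      also have "\<dots> = measure lebesgue (\<Union>\<D>)" by (rule content_division[OF div])
      also have "\<dots> \<le> measure lebesgue U"
      proof (rule measure_mono_fmeasurable)
        show "\<Union>\<D> \<subseteq> U" using K by blast
      qed (use \<open>U \<in> lmeasurable\<close> lmeasurable_division[OF div] in auto)
      finally have len: "(\<Sum>k\<in>\<D>. Sup k - Inf k) < d" using mU by simp
      have "\<Union>\<D> \<subseteq> {a..b}"
        using tagged_partial_division_ofD(3)[OF q] unfolding \<D>_def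
        by (intro Union_least) (metis imageE prod.collapse)
      then have var: "(\<Sum>k\<in>\<D>. \<bar>u (Sup k) - u (Inf k)\<bar>) < e"
        using d0[OF div] len by (simp add: d_def)
      have "(\<Sum>(t, K)\<in>q. B K) = (\<Sum>K\<in>\<D>. B K)"
        unfolding \<D>_def
        by (rule sum.over_tagged_division_lemma[OF tagged_partial_division_of_Union_self[OF q]])
           (auto simp: B_def box_real)
      also have "\<dots> = (\<Sum>k\<in>\<D>. \<bar>u (Sup k) - u (Inf k)\<bar>) + m * (\<Sum>k\<in>\<D>. Sup k - Inf k)"
        unfolding sum_distrib_left sum.distrib[symmetric]
      proof (rule sum.cong)
        fix k assume "k \<in> \<D>"
        then have "k \<noteq> {}" using K by force
        then show "B k = \<bar>u (Sup k) - u (Inf k)\<bar> + m * (Sup k - Inf k)" by (simp add: B_def)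
      qed simp
      also have "\<dots> \<le> e + m * d" using var len \<open>m \<ge> 0\<close> by (intro add_mono mult_left_mono) auto
      finally show ?thesis using md by linarith
    qed
    have "(c - e) * (b - a) - 2 * e \<le> (c - e) * (b - a) - (\<Sum>(t, K)\<in>q. B K)"
      using sumB by simp
    also have "\<dots> = (c - e) * (\<Sum>(t, K)\<in>p. Sup K - Inf K) - (\<Sum>(t, K)\<in>p. if t \<in> N then B K else 0)"
    proof -
      have "b - a = (\<Sum>(t, K)\<in>p. Sup K - Inf K)"
        using additive_tagged_division_1[OF \<open>a \<le> b\<close> p(1), of "\<lambda>t. t"] by simp
      moreover have "(\<Sum>(t, K)\<in>q. B K) = (\<Sum>(t, K)\<in>p. if t \<in> N then B K else 0)"
        using \<open>finite p\<close> qp by (intro sum.mono_neutral_cong_left) (auto simp: q_def split: if_splits)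
      ultimately show ?thesis by simp
    qed
    also have "\<dots>
      = (\<Sum>(t, K)\<in>p. (c - e) * (Sup K - Inf K) - (if t \<in> N then B K else 0))"
      by (simp add: sum_subtractf split_def flip: sum_distrib_left)
    also have "\<dots> \<le> (\<Sum>(t, K)\<in>p. u (Sup K) - u (Inf K))"
    proof (rule sum_mono, clarify)
      fix t K assume tK: "(t, K) \<in> p"
      from tag[OF this] obtain v w where vw: "K = {v..w}" "v \<le> t" "t \<le> w" "Sup K = w" "Inf K = v" "t \<in> {a..b}"
        by blast
      show "(c - e) * (Sup K - Inf K) - (if t \<in> N then B K else 0) \<le> u (Sup K) - u (Inf K)"
      proof (cases "t \<in> N")
        case True
        have "(c - e) * (w - v) \<le> m * (w - v)" using vw by (intro mult_right_mono) (auto simp: m_def)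
        then show ?thesis using True vw by (simp add: B_def) 
      next
        case False
        have "K \<subseteq> \<gamma> t" using p(2) tK by blast
        then have "{v, w} \<subseteq> \<gamma> t" using vw by auto
        with \<gamma>(4)[of t v w] False vw show ?thesis by simp
      qed
    qed
    also have "\<dots> = u b - u a" by (rule additive_tagged_division_1[OF \<open>a \<le> b\<close> p(1)])
    finally show ?thesis by (simp add: algebra_simps)
  qed
  show ?thesis
  proof (rule field_le_epsilon)
    fix e :: real assume "e > 0"
    then show "c * (b - a) \<le> u b - u a + e"
      using main[of "e / (b - a + 2)"] \<open>a \<le> b\<close> by simp
  qed
qed

text \<open>After the last point \<open>s\<close> with \<open>u s \<le> M\<close>, the function
  stays above \<open>M\<close>, so its derivative is nonpositive almost everywhere on
  \<open>[s, b]\<close> and \<open>u b \<le> u s\<close>.\<close>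

lemma abs_continuous_upper_barrier:
  assumes "a \<le> b" and ac: "abs_continuous_on_Icc a b u" and N: "negligible N"
    and deriv: "\<And>t. t \<in> {a..b} - N \<Longrightarrow> u t > M \<Longrightarrow> \<exists>D\<le>0. (u has_real_derivative D) (at t)"
    and "u a \<le> M"
  shows "u b \<le> M"
proof (rule ccontr)
  assume "\<not> u b \<le> M"
  have cont: "continuous_on {a..b} u" using ac by (rule abs_continuous_on_Icc_imp_continuous_on)
  define S where "S = {t \<in> {a..b}. u t \<le> M}"
  have "closed S" unfolding S_def
    by (intro continuous_on_closed_Collect_le[OF cont]) auto
  then have "compact S" by (auto simp: S_def compact_eq_bounded_closed intro: bounded_subset[of "{a..b}"])
  moreover have "a \<in> S" using assms by (auto simp: S_def)
  ultimately obtain s where s: "s \<in> S" "\<And>t. t \<in> S \<Longrightarrow> t \<le> s"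
    using compact_attains_sup[of S] by auto
  have sab: "a \<le> s" "s \<le> b" "u s \<le> M" using s by (auto simp: S_def)
  \<comment> \<open>The increment bound is applied to \<open>- u\<close> with \<open>c = 0\<close>.
    The point \<open>s\<close> joins the exceptional set because \<open>deriv\<close> says nothing
    where \<open>u \<le> M\<close>.\<close>
  have "0 * (b - s) \<le> - u b - - u s"
  proof (rule abs_continuous_increment_ge[where N = "insert s N"])
    show "abs_continuous_on_Icc s b (\<lambda>t. - u t)"
      using abs_continuous_on_Icc_subset[OF ac, of s b] sab by (simp add: abs_continuous_on_Icc_minus)
    fix t assume t: "t \<in> {s..b} - insert s N"
    then have "t \<notin> S" using s(2)[of t] by auto
    then have "u t > M" using t sab by (auto simp: S_def)
    then obtain D where "D \<le> 0" "(u has_real_derivative D) (at t)" using deriv[of t] t sab by auto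
    then show "\<exists>D\<ge>0. ((\<lambda>t. - u t) has_real_derivative D) (at t)"
      by (intro exI[of _ "- D"]) (auto intro: DERIV_minus)
  qed (use N sab in auto)
  with sab \<open>\<not> u b \<le> M\<close> show False by simp
qed

lemma abs_continuous_lower_barrier:
  assumes "a \<le> b" and ac: "abs_continuous_on_Icc a b u" and N: "negligible N"
    and deriv: "\<And>t. t \<in> {a..b} - N \<Longrightarrow> u t < M \<Longrightarrow> \<exists>D\<ge>0. (u has_real_derivative D) (at t)"
    and "M \<le> u a"
  shows "M \<le> u b"
proof -
  have "- u b \<le> - M"
  proof (rule abs_continuous_upper_barrier[OF \<open>a \<le> b\<close> _ N])
    fix t assume "t \<in> {a..b} - N" "- u t > - M"
    then obtain D where "D \<ge> 0" "(u has_real_derivative D) (at t)" using deriv[of t] by auto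
    then show "\<exists>D\<le>0. ((\<lambda>t. - u t) has_real_derivative D) (at t)"
      by (intro exI[of _ "- D"]) (auto intro: DERIV_minus)
  qed (use assms in \<open>auto simp: abs_continuous_on_Icc_minus\<close>)
  then show ?thesis by simp
qed

section \<open>Stieltjes integrals against probability distributions\<close>

text \<open>The right limit of a monotone function is its infimum over \<open>{s<..}\<close>. This
  existence is what gives the term \<open>Lim (at_right s) F\<close> a meaning.\<close>

lemma mono_tendsto_Lim_at_right:
  fixes F :: "real \<Rightarrow> real"
  assumes "mono F"
  shows "(F \<longlongrightarrow> Lim (at_right s) F) (at_right s)"
proof -
  have "(F \<longlongrightarrow> Inf (F ` ({s<..} \<inter> UNIV))) (at s within ({s<..} \<inter> UNIV))"
    using assms by (intro Lim_right_bound[where K = "F s"]) (auto simp: mono_def)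
  then have "(F \<longlongrightarrow> Inf (F ` {s<..})) (at_right s)" by simp
  with tendsto_Lim[OF trivial_limit_at_right_real this] show ?thesis by simp
qed

lemma Lim_at_right_le:
  fixes F :: "real \<Rightarrow> real"
  assumes "mono F" "s < t"
  shows "Lim (at_right s) F \<le> F t"
proof (rule tendsto_upperbound[OF mono_tendsto_Lim_at_right[OF assms(1)]])
  show "\<forall>\<^sub>F x in at_right s. F x \<le> F t"
    using assms unfolding eventually_at_right_field by (auto simp: mono_def intro!: exI[of _ t])
qed simp

lemma le_Lim_at_right:
  fixes F :: "real \<Rightarrow> real"
  assumes "mono F"
  shows "F s \<le> Lim (at_right s) F"
proof (rule tendsto_lowerbound[OF mono_tendsto_Lim_at_right[OF assms(1)]])
  show "\<forall>\<^sub>F x in at_right s. F s \<le> F x"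
    using eventually_at_right_less[of s] by (rule eventually_mono) (use assms in \<open>auto simp: mono_def\<close>)
qed simp

lemma mono_Lim_at_right:
  fixes F :: "real \<Rightarrow> real"
  assumes "mono F" "s \<le> t"
  shows "Lim (at_right s) F \<le> Lim (at_right t) F"
proof (cases "s = t")
  case False
  then show ?thesis
    using Lim_at_right_le[OF assms(1), of s t] le_Lim_at_right[OF assms(1), of t] assms by linarith
qed simp

text \<open>Together with monotonicity, this permits the formula for the mass of half-open intervals
  under \<open>interval_measure\<close>.\<close>

lemma continuous_at_right_Lim_at_right:
  fixes F :: "real \<Rightarrow> real"
  assumes "mono F"
  shows "continuous (at_right s) (\<lambda>s. Lim (at_right s) F)"
  unfolding continuous_within
proof (rule order_tendstoI)
  fix a assume "a < Lim (at_right s) F"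
  then show "\<forall>\<^sub>F x in at_right s. a < Lim (at_right x) F"
    by (intro eventually_mono[OF eventually_at_right_less[of s]])
       (meson less_le_trans less_imp_le mono_Lim_at_right[OF assms])
next
  fix a assume "Lim (at_right s) F < a"
  then have "\<forall>\<^sub>F x in at_right s. F x < a"
    using order_tendstoD(2)[OF mono_tendsto_Lim_at_right[OF assms]] by blast
  then obtain b where b: "b > s" "\<And>x. s < x \<Longrightarrow> x < b \<Longrightarrow> F x < a"
    unfolding eventually_at_right_field by blast
  \<comment> \<open>The right limit at \<open>x\<close> is bounded by values of \<open>F\<close>
    strictly to the right of \<open>x\<close>; the midpoint of \<open>x\<close> and \<open>b\<close>
    is such a point and still lies below \<open>b\<close>.\<close>
  have "Lim (at_right x) F < a" if "s < x" "x < b" for x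
    using Lim_at_right_le[OF assms, of x "(x + b) / 2"] b(2)[of "(x + b) / 2"] that by auto
  with b(1) show "\<forall>\<^sub>F x in at_right s. Lim (at_right x) F < a"
    unfolding eventually_at_right_field by blast
qed

text \<open>\<open>{a..b}\<close> is \<open>{a - 1<..b}\<close> without \<open>{a - 1<..<a}\<close>.
  The former has mass \<open>?L b - ?L (a - 1) = 1\<close>, and the latter is null because
  \<open>?L\<close> vanishes to the left of \<open>a\<close>.\<close>

lemma emeasure_stieltjes_eq_1:
  fixes F :: "real \<Rightarrow> real"
  assumes F: "mono F" and zero: "\<And>s. s \<le> a \<Longrightarrow> F s = 0" and one: "(F \<longlongrightarrow> 1) (at_right b)" and "a \<le> b"
  shows "emeasure (interval_measure (\<lambda>s. Lim (at_right s) F)) {a..b} = 1"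
proof -
  let ?L = "\<lambda>s. Lim (at_right s) F" and ?M = "interval_measure (\<lambda>s. Lim (at_right s) F)"
  have Ioc: "emeasure ?M {c<..d} = ?L d - ?L c" if "c \<le> d" for c d
    using that by (intro emeasure_interval_measure_Ioc mono_Lim_at_right continuous_at_right_Lim_at_right F)
  have L0: "?L s = 0" if "s < a" for s
    using Lim_at_right_le[OF F that] le_Lim_at_right[OF F, of s] zero[of s] zero[of a] that by simp
  have L1: "?L b = 1" using tendsto_Lim[OF trivial_limit_at_right_real one] .
  \<comment> \<open>The half-open intervals end strictly before \<open>a\<close>, since an atom at
    \<open>a\<close> makes \<open>?L a\<close> positive.\<close>
  have "(\<Union>n. {a - 1<..a - 1 / real (Suc n)}) \<in> null_sets ?M"
  proof (rule null_sets_UN)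
    fix n
    have "a - 1 \<le> a - 1 / real (Suc n)" by simp
    then show "{a - 1<..a - 1 / real (Suc n)} \<in> null_sets ?M"
      using Ioc[of "a - 1" "a - 1 / real (Suc n)"] L0[of "a - 1"] L0[of "a - 1 / real (Suc n)"]
      by (intro null_setsI) auto
  qed
  moreover have "{a - 1<..<a} \<subseteq> (\<Union>n. {a - 1<..a - 1 / real (Suc n)})"
  proof
    fix t assume t: "t \<in> {a - 1<..<a}"
    then obtain n where "inverse (real (Suc n)) < a - t" using reals_Archimedean[of "a - t"] by auto
    then show "t \<in> (\<Union>n. {a - 1<..a - 1 / real (Suc n)})"
      using t by (auto simp: inverse_eq_divide intro!: exI[of _ n])
  qed
  ultimately have null: "{a - 1<..<a} \<in> null_sets ?M" by (auto intro: null_sets_subset)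
  have "emeasure ?M {a..b} = emeasure ?M ({a - 1<..b} - {a - 1<..<a})"
    using \<open>a \<le> b\<close> by (intro arg_cong[where f = "emeasure ?M"]) auto
  also have "\<dots> = emeasure ?M {a - 1<..b}" using null by (intro emeasure_Diff_null_set) auto
  also have "\<dots> = 1" using Ioc[of "a - 1" b] L0[of "a - 1"] L1 \<open>a \<le> b\<close> by simp
  finally show ?thesis .
qed

text \<open>The measure has mass 1 on \<open>{a..b}\<close>, so the constant \<open>c\<close>
  integrates to \<open>c\<close>; monotonicity of the integral does the rest. Integrability holds
  because \<open>g\<close> is bounded on a compact interval.\<close>

lemma stieltjes_integral_bounds:
  fixes F g :: "real \<Rightarrow> real"
  assumes "mono F" and "\<And>s. s \<le> a \<Longrightarrow> F s = 0" and "(F \<longlongrightarrow> 1) (at_right b)" and "a \<le> b"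
    and g: "continuous_on {a..b} g"
  shows "(\<And>s. s \<in> {a..b} \<Longrightarrow> g s \<le> c) \<Longrightarrow> stieltjes_integral a b g F \<le> c"
    and "(\<And>s. s \<in> {a..b} \<Longrightarrow> c \<le> g s) \<Longrightarrow> c \<le> stieltjes_integral a b g F"
proof -
  let ?M = "interval_measure (\<lambda>s. Lim (at_right s) F)"
  have one: "emeasure ?M {a..b} = 1" using assms(1-4) by (rule emeasure_stieltjes_eq_1)
  have "bounded (g ` {a..b})" using compact_continuous_image[OF g] by (simp add: compact_imp_bounded)
  then obtain B where B: "\<And>s. s \<in> {a..b} \<Longrightarrow> norm (g s) \<le> B" 
    unfolding bounded_iff by blast
  have "(\<lambda>s. indicator {a..b} s *\<^sub>R g s) \<in> borel_measurable borel"
    using g by (intro borel_measurable_continuous_on_indicator) auto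
  then have int: "set_integrable ?M {a..b} g"
    unfolding set_integrable_def using B one
    by (intro integrableI_bounded_set[where A = "{a..b}" and B = B]) auto
  have intc: "set_integrable ?M {a..b} (\<lambda>_. c)"
    unfolding set_integrable_def using one by (intro integrable_scaleR_left integrable_real_indicator) auto
  have c: "set_lebesgue_integral ?M {a..b} (\<lambda>_. c) = c"
    using one by (simp add: set_lebesgue_integral_def measure_def)
  show "stieltjes_integral a b g F \<le> c" if "\<And>s. s \<in> {a..b} \<Longrightarrow> g s \<le> c"
    using set_integral_mono[OF int intc] that c unfolding stieltjes_integral_def by simp
  show "c \<le> stieltjes_integral a b g F" if "\<And>s. s \<in> {a..b} \<Longrightarrow> c \<le> g s"
    using set_integral_mono[OF intc int] that c unfolding stieltjes_integral_def by simp
qed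

section \<open>One component of the system\<close>

text \<open>One equation of the system, with the other unknown \<open>y\<close> treated as a given
  continuous input. It is interpreted twice, with the roles of \<open>x\<close> and \<open>y\<close>
  exchanged.\<close>

locale delayed_component =
  fixes r G f h x y :: "real \<Rightarrow> real" and R :: "real \<Rightarrow> real \<Rightarrow> real"
  assumes rate: "rate_function r" and gain: "gain_function G" and feedback: "feedback_function f"
    and delay: "delay_function h" and kernel: "delay_kernel h R"
    and ac: "locally_abs_continuous x" and cont_y: "continuous_on UNIV y"
    and deriv: "AE t in lebesgue_on {0..}. (x has_real_derivative
      r t * G (x t) * (stieltjes_integral (h t) t (\<lambda>s. f (y s)) (R t) - x t)) (at t)"
begin

definition forcing :: "real \<Rightarrow> real" where
  "forcing t = stieltjes_integral (h t) t (\<lambda>s. f (y s)) (R t)"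

lemma abs_continuous: "0 \<le> a \<Longrightarrow> abs_continuous_on_Icc a b x"
  by (rule abs_continuous_on_Icc_subset[of 0 "max b 1"]) (use ac in \<open>auto simp: locally_abs_continuous_def\<close>)

lemma feedback_mono: "0 \<le> a \<Longrightarrow> a \<le> b \<Longrightarrow> f a \<le> f b"
  using feedback strict_mono_on_leD[of "{0..}" f a b] by (simp add: feedback_function_def)

lemma rate_gain_nonneg: "0 \<le> t \<Longrightarrow> 0 \<le> x t \<Longrightarrow> 0 \<le> r t * G (x t)"
  using rate gain by (auto simp: rate_function_def gain_function_def)

text \<open>The differential equation and the essential bound on \<open>r\<close> are put off one
  common null set, as the increment and barrier lemmas require.\<close>

lemma derivative_off_null:
  obtains N C where "negligible N" "C \<ge> 0" "\<forall>t\<ge>0. t \<notin> N \<longrightarrow> r t \<le> C"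
    "\<forall>t\<ge>0. t \<notin> N \<longrightarrow> (x has_real_derivative r t * G (x t) * (forcing t - x t)) (at t)"
proof -
  obtain C where C: "AE t in lebesgue_on {0..}. \<bar>r t\<bar> \<le> C"
    using rate unfolding rate_function_def by blast
  have "AE t in lebesgue. t \<in> {0..} \<longrightarrow>
      (x has_real_derivative r t * G (x t) * (forcing t - x t)) (at t) \<and> \<bar>r t\<bar> \<le> C"
    using AE_conjI[OF deriv C] by (subst (asm) AE_restrict_space_iff) (auto simp: forcing_def)
  then obtain N where N: "N \<in> null_sets lebesgue"
    "\<And>t. t \<notin> N \<Longrightarrow> t \<in> {0..} \<Longrightarrow>
      (x has_real_derivative r t * G (x t) * (forcing t - x t)) (at t) \<and> \<bar>r t\<bar> \<le> C"
    by (auto elim!: AE_E3)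
  show thesis
  proof (rule that[of N "max C 0"])
    show "\<forall>t\<ge>0. t \<notin> N \<longrightarrow> r t \<le> max C 0" using N(2) by fastforce
  qed (use N in \<open>auto simp: negligible_iff_null_sets\<close>)
qed

text \<open>\<open>forcing t\<close> is an average of \<open>f (y s)\<close> over \<open>s\<close>
  in \<open>[h t, t]\<close> with respect to a probability measure. Nonnegativity of
  \<open>y\<close> keeps the arguments of \<open>f\<close> where it is continuous and
  increasing.\<close>

lemma forcing_bounds:
  assumes "0 \<le> t" and y: "\<And>s. s \<le> t \<Longrightarrow> 0 \<le> y s"
  shows "(\<And>s. s \<le> t \<Longrightarrow> y s \<le> B) \<Longrightarrow> forcing t \<le> f B"
    and "0 \<le> A \<Longrightarrow> (\<And>s. s \<le> t \<Longrightarrow> A \<le> y s) \<Longrightarrow> f A \<le> forcing t"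
proof -
  have "continuous_on {0..} f" using feedback by (simp add: feedback_function_def)
  then have "continuous_on {h t..t} (\<lambda>s. f (y s))"
    using y by (intro continuous_on_compose2[OF _ continuous_on_subset[OF cont_y]]) auto
  note bounds = stieltjes_integral_bounds[of "R t" "h t" t, OF _ _ _ _ this]
  have R: "mono (R t)" "\<And>s. s \<le> h t \<Longrightarrow> R t s = 0" "(R t \<longlongrightarrow> 1) (at_right t)" "h t \<le> t"
    using kernel delay \<open>0 \<le> t\<close> by (auto simp: delay_kernel_def delay_function_def)
  show "forcing t \<le> f B" if "\<And>s. s \<le> t \<Longrightarrow> y s \<le> B"
    unfolding forcing_def
  proof (rule bounds(1))
    fix s assume "s \<in> {h t..t}"
    then show "f (y s) \<le> f B" using that y by (intro feedback_mono) auto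
  qed (use R in auto)
  show "f A \<le> forcing t" if "0 \<le> A" "\<And>s. s \<le> t \<Longrightarrow> A \<le> y s"
    unfolding forcing_def
  proof (rule bounds(2))
    fix s assume "s \<in> {h t..t}"
    then show "f A \<le> f (y s)" using that y by (intro feedback_mono) auto
  qed (use R in auto)
qed

text \<open>Where \<open>x\<close> exceeds \<open>f B\<close>, it exceeds \<open>forcing\<close> as
  well, and the factor \<open>r t * G (x t)\<close> is nonnegative; hence \<open>f B\<close> is a
  barrier for \<open>x\<close>.\<close>

lemma upper_bound:
  assumes "0 \<le> T" and y: "\<And>s. s \<le> T \<Longrightarrow> 0 \<le> y s" "\<And>s. s \<le> T \<Longrightarrow> y s \<le> B"
    and x: "\<And>s. 0 \<le> s \<Longrightarrow> s \<le> T \<Longrightarrow> 0 \<le> x s" and "x 0 \<le> f B"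
  shows "x T \<le> f B"
proof -
  obtain N where N: "negligible N"
    "\<forall>t\<ge>0. t \<notin> N \<longrightarrow> (x has_real_derivative r t * G (x t) * (forcing t - x t)) (at t)"
    by (rule derivative_off_null) blast
  show ?thesis
  proof (rule abs_continuous_upper_barrier[OF \<open>0 \<le> T\<close> abs_continuous N(1)])
    fix t assume t: "t \<in> {0..T} - N" "f B < x t"
    have "forcing t \<le> f B" using t y by (intro forcing_bounds) auto
    then have "r t * G (x t) * (forcing t - x t) \<le> 0"
      using t x by (intro mult_nonneg_nonpos rate_gain_nonneg) auto
    then show "\<exists>D\<le>0. (x has_real_derivative D) (at t)" using N(2) t by auto
  qed (use assms in auto)
qed

lemma lower_bound:
  assumes "0 \<le> T" and "0 \<le> A" and y: "\<And>s. s \<le> T \<Longrightarrow> A \<le> y s"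
    and x: "\<And>s. 0 \<le> s \<Longrightarrow> s \<le> T \<Longrightarrow> 0 \<le> x s" and "f A \<le> x 0"
  shows "f A \<le> x T"
proof -
  obtain N where N: "negligible N"
    "\<forall>t\<ge>0. t \<notin> N \<longrightarrow> (x has_real_derivative r t * G (x t) * (forcing t - x t)) (at t)"
    by (rule derivative_off_null) blast
  show ?thesis
  proof (rule abs_continuous_lower_barrier[OF \<open>0 \<le> T\<close> abs_continuous N(1)])
    fix t assume t: "t \<in> {0..T} - N" "x t < f A"
    have "0 \<le> y s" if "s \<le> t" for s using y[of s] that t \<open>0 \<le> A\<close> by auto
    then have "f A \<le> forcing t" using t y \<open>0 \<le> A\<close> by (intro forcing_bounds) auto
    then have "r t * G (x t) * (forcing t - x t) \<ge> 0"
      using t x by (intro mult_nonneg_nonneg rate_gain_nonneg) auto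
    then show "\<exists>D\<ge>0. (x has_real_derivative D) (at t)" using N(2) t by auto
  qed (use assms in auto)
qed

text \<open>The forcing is nonnegative and \<open>r t * G (x t)\<close> is essentially bounded on
  \<open>[0, T]\<close> by some \<open>m\<close>, so \<open>x' \<ge> - m x\<close> almost
  everywhere, and \<open>x\<close> cannot decay to 0 in finite time.\<close>

lemma positive_at_limit:
  assumes "0 < T" and y: "\<And>s. s \<le> T \<Longrightarrow> 0 \<le> y s" and x: "\<And>s. 0 \<le> s \<Longrightarrow> s < T \<Longrightarrow> 0 < x s"
  shows "0 < x T"
proof -
  obtain N C where N: "negligible N" "C \<ge> 0" "\<forall>t\<ge>0. t \<notin> N \<longrightarrow> r t \<le> C"
    "\<forall>t\<ge>0. t \<notin> N \<longrightarrow> (x has_real_derivative r t * G (x t) * (forcing t - x t)) (at t)"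
    by (rule derivative_off_null)
  have contx: "continuous_on {a..T} x" if "0 \<le> a" for a
    using that by (intro abs_continuous_on_Icc_imp_continuous_on abs_continuous)
  \<comment> \<open>Nonnegativity at the endpoint comes from left continuity. It keeps
    \<open>x\<close> in the domain of \<open>G\<close> on all of \<open>[0, T]\<close>, so that
    \<open>G (x s)\<close> is bounded there.\<close>
  have xT: "0 \<le> x T"
  proof (rule tendsto_lowerbound)
    show "(x \<longlongrightarrow> x T) (at_left T)"
      using contx[of 0] \<open>0 < T\<close> by (simp add: continuous_on_Icc_at_leftD)
    show "\<forall>\<^sub>F t in at_left T. 0 \<le> x t"
      unfolding eventually_at_left_field
    proof (intro exI conjI allI impI)
      show "0 \<le> x t" if "0 < t" "t < T" for t using x[of t] that by simp
    qed (rule \<open>0 < T\<close>)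
  qed simp
  then have xnn: "0 \<le> x s" if "0 \<le> s" "s \<le> T" for s using x[of s] that by (cases "s = T") auto
  have "continuous_on {0..T} (\<lambda>s. G (x s))"
    by (rule continuous_on_compose2[of "{0..}" G]) (use gain contx[of 0] xnn in \<open>auto simp: gain_function_def\<close>)
  then have "bounded ((\<lambda>s. G (x s)) ` {0..T})"
    by (simp add: compact_continuous_image compact_imp_bounded)
  then obtain g where g: "\<forall>z \<in> (\<lambda>s. G (x s)) ` {0..T}. norm z \<le> g"
    unfolding bounded_iff by blast
  \<comment> \<open>The summand 1 makes \<open>m\<close> positive, so that the length
    \<open>1 / (2 * m)\<close> is available.\<close>
  define m where "m = C * max g 0 + 1"
  have "m > 0" using N(2) by (simp add: m_def add_nonneg_pos)
  have rG: "r t * G (x t) \<le> m" if "0 \<le> t" "t \<le> T" "t \<notin> N" for t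
  proof -
    have "G (x t) \<ge> 0" using gain xnn that by (auto simp: gain_function_def)
    moreover have Gg: "G (x t) \<le> g" using bspec[OF g, of "G (x t)"] that by auto
    moreover have "r t \<le> C" using N(3) that by blast
    ultimately have "r t * G (x t) \<le> C * max g 0" using N(2) by (intro mult_mono) simp_all
    then show ?thesis by (simp add: m_def)
  qed
  define a0 where "a0 = max 0 (T - 1 / (2 * m))"
  have a0: "0 \<le> a0" "a0 < T" "m * (T - a0) \<le> 1 / 2"
  proof -
    have "m * (T - a0) \<le> m * (1 / (2 * m))"
      using \<open>m > 0\<close> unfolding a0_def by (intro mult_left_mono) auto
    then show "m * (T - a0) \<le> 1 / 2" using \<open>m > 0\<close> by simp
  qed (use \<open>0 < T\<close> \<open>m > 0\<close> in \<open>auto simp: a0_def\<close>)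
  \<comment> \<open>Starting at a maximum \<open>a\<close> of \<open>x\<close> within \<open>1 / (2 m)\<close> of \<open>T\<close>, the bound \<open>x' \<ge> - m x \<ge> - m x(a)\<close>
    costs at most half of \<open>x(a)\<close>.\<close>
  obtain a where a: "a \<in> {a0..T}" "\<And>t. t \<in> {a0..T} \<Longrightarrow> x t \<le> x a"
    using continuous_attains_sup[OF compact_Icc _ contx[OF a0(1)]] a0 by auto
  have "x a > 0" using a(2)[of a0] x[of a0] a0 by auto
  have "- (m * x a) * (T - a) \<le> x T - x a"
  proof (rule abs_continuous_increment_ge[OF _ abs_continuous N(1)])
    fix t assume t: "t \<in> {a..T} - N"
    have "0 \<le> forcing t"
    proof -
      have "f 0 \<le> forcing t" using t a a0 y by (intro forcing_bounds) auto
      then show ?thesis using feedback by (auto simp: feedback_function_def intro: order_trans)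
    qed
    moreover have "x t \<le> x a" "0 \<le> x t" using a(2)[of t] xnn[of t] t a a0 by auto
    moreover have "0 \<le> r t * G (x t)" "r t * G (x t) \<le> m"
      using rate_gain_nonneg[of t] rG[of t] t a a0 xnn[of t] by auto
    ultimately have "0 \<le> (r t * G (x t)) * forcing t" "(r t * G (x t)) * x t \<le> m * x a"
      using \<open>m > 0\<close> by - (rule mult_nonneg_nonneg, simp_all, rule mult_mono, simp_all)
    then have "r t * G (x t) * (forcing t - x t) \<ge> - (m * x a)" by (simp add: right_diff_distrib)
    then show "\<exists>D\<ge>- (m * x a). (x has_real_derivative D) (at t)" using N(4) t a a0 by auto
  qed (use a a0 in auto)
  moreover have "(m * (T - a)) * x a \<le> 1 / 2 * x a"
  proof (rule mult_right_mono)
    have "m * (T - a) \<le> m * (T - a0)" using a \<open>m > 0\<close> by (intro mult_left_mono) auto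
    then show "m * (T - a) \<le> 1 / 2" using a0 by linarith
  qed (use \<open>x a > 0\<close> in simp)
  ultimately show ?thesis using \<open>x a > 0\<close> by (simp add: algebra_simps)
qed

end

section \<open>Continuity and positivity of solutions\<close>

lemma solution_continuous:
  assumes "locally_abs_continuous x" "initial_function \<phi>" "\<And>t. t \<le> 0 \<Longrightarrow> x t = \<phi> t"
  shows "continuous_on UNIV x"
proof -
  have neg: "continuous_on {..0} x"
    using assms continuous_on_cong[of "{..0}" "{..0}" x \<phi>] by (auto simp: initial_function_def)
  have "continuous_on {..T} x" if "T > 0" for T
  proof -
    have "continuous_on {0..T} x"
      using assms that by (simp add: locally_abs_continuous_def abs_continuous_on_Icc_imp_continuous_on)
    with neg have "continuous_on ({..0} \<union> {0..T}) x" by (intro continuous_on_closed_Un) auto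
    moreover have "{..0} \<union> {0..T} = {..T}" using that by auto
    ultimately show ?thesis by simp
  qed
  \<comment> \<open>An open half-line containing \<open>t\<close> turns continuity on a set into
    continuity at the point \<open>t\<close>.\<close>
  then have "continuous_on {..<max t 0 + 1} x" for t
    by (rule continuous_on_subset[of "{..max t 0 + 1}"]) auto
  then have "isCont x t" for t
    using continuous_on_eq_continuous_at[of "{..<max t 0 + 1}" x] by auto
  then show ?thesis by (simp add: continuous_at_imp_continuous_on)
qed

text \<open>At the first time \<open>s\<close> where a component fails to be positive, both are
  nonnegative up to \<open>s\<close> and positive on \<open>[0, s)\<close>. Then
  \<open>positive_at_limit\<close>, applied to each equation, makes both positive at
  \<open>s\<close>.\<close>

lemma positive_pair:
  assumes X: "delayed_component r1 G1 f1 h1 x y R1" and Y: "delayed_component r2 G2 f2 h2 y x R2"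
    and neg: "\<And>t. t \<le> 0 \<Longrightarrow> 0 \<le> x t \<and> 0 \<le> y t" and zero: "0 < x 0" "0 < y 0"
    and "0 \<le> T"
  shows "0 < x T \<and> 0 < y T"
proof (rule ccontr)
  assume neg_T: "\<not> (0 < x T \<and> 0 < y T)"
  have cont: "continuous_on UNIV x" "continuous_on UNIV y"
    using X Y by (auto simp: delayed_component_def)
  define S where "S = {0..T} \<inter> {t. min (x t) (y t) \<le> 0}"
  have "compact S" unfolding S_def
  proof (rule compact_Int_closed)
    show "closed {t. min (x t) (y t) \<le> 0}"
      by (rule closed_Collect_le) (use cont in \<open>auto intro: continuous_on_min\<close>)
  qed simp
  moreover have "T \<in> S" using neg_T \<open>0 \<le> T\<close> by (auto simp: S_def)
  ultimately obtain s where s: "s \<in> S" "\<And>t. t \<in> S \<Longrightarrow> s \<le> t"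
    using compact_attains_inf[of S] by auto
  have "0 < s" using s(1) zero by (cases "s = 0") (auto simp: S_def)
  have pos: "0 < x t \<and> 0 < y t" if "0 \<le> t" "t < s" for t
    using s(2)[of t] s(1) that by (force simp: S_def)
  have nonneg: "0 \<le> x t \<and> 0 \<le> y t" if "t \<le> s" for t
  proof -
    have "t \<in> closure {..<s}" using that by simp
    moreover have "closed {t. 0 \<le> x t \<and> 0 \<le> y t}"
      by (rule closed_Collect_conj; rule closed_Collect_le) (use cont in simp_all)
    moreover have "{..<s} \<subseteq> {t. 0 \<le> x t \<and> 0 \<le> y t}"
    proof
      fix t assume "t \<in> {..<s}"
      then show "t \<in> {t. 0 \<le> x t \<and> 0 \<le> y t}"
        using pos[of t] neg[of t] by (cases "t \<le> 0") auto
    qed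
    ultimately show ?thesis using closure_minimal[of "{..<s}" "{t. 0 \<le> x t \<and> 0 \<le> y t}"] by blast
  qed
  have "0 < x s"
    by (rule delayed_component.positive_at_limit[OF X \<open>0 < s\<close>]) (use nonneg pos in auto)
  moreover have "0 < y s"
    by (rule delayed_component.positive_at_limit[OF Y \<open>0 < s\<close>]) (use nonneg pos in auto)
  ultimately show False using s(1) by (auto simp: S_def)
qed

section \<open>The extended inverse of a feedback function\<close>

lemma ext_inverse_range:
  assumes "feedback_function f" "p \<ge> 0"
  shows "ext_inverse f (f p) = ereal p"
proof -
  have "inj_on f {0..}"
    using assms by (auto simp: feedback_function_def intro: strict_mono_on_imp_inj_on)
  then show ?thesis using assms by (auto simp: ext_inverse_def the_inv_into_f_f)
qed

text \<open>By the intermediate value theorem on \<open>[0, b]\<close>. It serves to exclude the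
  default values of \<open>ext_inverse\<close>.\<close>

lemma feedback_range:
  assumes "feedback_function f" "f 0 \<le> z" "z \<le> f b" "0 \<le> b"
  shows "\<exists>p\<ge>0. f p = z"
proof -
  have "continuous_on {0..b} f"
    using assms by (auto simp: feedback_function_def intro: continuous_on_subset)
  then show ?thesis using IVT'[of f 0 z b] assms by auto
qed

lemma feedback_less: "feedback_function f \<Longrightarrow> 0 \<le> a \<Longrightarrow> a < b \<Longrightarrow> f a < f b"
  by (auto simp: feedback_function_def strict_mono_on_def)

section \<open>Comparison of solutions with the equilibrium \<open>(K, f2 K)\<close>\<close>

theorem theorem3p18:
  fixes f1 f2 G1 G2 h1 h2 r1 r2 \<phi> \<psi> x y :: "real \<Rightarrow> real"
    and R1 R2 :: "real \<Rightarrow> real \<Rightarrow> real"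
    and K :: real
  assumes "feedback_function f1" and "feedback_function f2"
    and "K > 0"
    and "\<forall>z>0. ext_inverse f1 z = ereal (f2 z) \<longleftrightarrow> z = K"
    and "\<forall>z. f1 0 < z \<and> z < K \<longrightarrow> ereal (f2 z) > ext_inverse f1 z"
    and "\<forall>z>K. ereal (f2 z) < ext_inverse f1 z"
    and "delay_function h1" and "delay_function h2"
    and "delay_kernel h1 R1" and "delay_kernel h2 R2"
    and "rate_function r1" and "rate_function r2"
    and "initial_function \<phi>" and "initial_function \<psi>"
    and "gain_function G1" and "gain_function G2"
    and "is_solution_PG r1 r2 G1 G2 f1 f2 h1 h2 R1 R2 \<phi> \<psi> x y"
  shows "((\<forall>t\<le>0. \<phi> t \<ge> K \<and> \<psi> t \<ge> f2 K) \<longrightarrow> (\<forall>t\<ge>0. x t \<ge> K \<and> y t \<ge> f2 K)) \<and>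
         ((\<forall>t\<le>0. \<phi> t \<le> K \<and> \<psi> t \<le> f2 K) \<longrightarrow> (\<forall>t\<ge>0. x t \<le> K \<and> y t \<le> f2 K))"
proof -
  note f1 = \<open>feedback_function f1\<close> and f2 = \<open>feedback_function f2\<close>
  have ac: "locally_abs_continuous x" "locally_abs_continuous y"
    and ode: "AE t in lebesgue_on {0..}.
        (x has_real_derivative
           r1 t * G1 (x t) * (stieltjes_integral (h1 t) t (\<lambda>s. f1 (y s)) (R1 t) - x t)) (at t) \<and>
        (y has_real_derivative
           r2 t * G2 (y t) * (stieltjes_integral (h2 t) t (\<lambda>s. f2 (x s)) (R2 t) - y t)) (at t)"
    and init: "\<And>t. t \<le> 0 \<Longrightarrow> x t = \<phi> t" "\<And>t. t \<le> 0 \<Longrightarrow> y t = \<psi> t"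
    using assms(17) by (auto simp: is_solution_PG_def)
  have cont: "continuous_on UNIV x" "continuous_on UNIV y"
    using solution_continuous ac init assms(13,14) by blast+
  interpret X: delayed_component r1 G1 f1 h1 x y R1
    by unfold_locales (use assms ac cont ode in auto)
  interpret Y: delayed_component r2 G2 f2 h2 y x R2
    by unfold_locales (use assms ac cont ode in auto)
  have neg: "0 \<le> x t \<and> 0 \<le> y t" if "t \<le> 0" for t
    using that init[of t] assms(13,14) unfolding initial_function_def
    by (cases "t = 0") (auto intro: less_imp_le)
  have zero: "0 < x 0" "0 < y 0" using init[of 0] assms(13,14) by (auto simp: initial_function_def)
  have pos: "0 < x t \<and> 0 < y t" if "0 \<le> t" for t
    by (rule positive_pair[OF X.delayed_component_axioms Y.delayed_component_axioms neg zero that])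
  have nonneg: "0 \<le> x t" "0 \<le> y t" for t using pos[of t] neg[of t] by (cases "t \<le> 0"; simp add: less_imp_le)+
  have f2K: "0 < f2 K" using f2 \<open>K > 0\<close> by (simp add: feedback_function_def)
  \<comment> \<open>\<open>ext_inverse f1 K\<close> is finite and positive, hence not one of the
    default values 0 and \<infinity>, so \<open>K\<close> lies in the range of
    \<open>f1\<close>.\<close>
  have f1f2K: "f1 (f2 K) = K"
  proof -
    have K: "ext_inverse f1 K = ereal (f2 K)" using assms(3,4) by blast
    with f2K have "K \<in> f1 ` {0..}" by (auto simp: ext_inverse_def zero_ereal_def split: if_splits)
    then obtain p where "p \<ge> 0" "K = f1 p" by auto
    with K ext_inverse_range[OF f1, of p] show ?thesis by simp
  qed
  have nf2: "0 \<le> f2 z" if "0 \<le> z" for z using f2 that by (simp add: feedback_function_def)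
  \<comment> \<open>The negation \<open>z \<le> f1 (f2 z)\<close> puts \<open>z\<close> in the range
    of \<open>f1\<close>; then the hypothesis compares real numbers, and applying \<open>f1\<close>
    to \<open>f2 z < p\<close> contradicts the negation.\<close>
  have above: "f1 (f2 z) < z" if "z > K" for z
  proof (rule ccontr)
    assume "\<not> f1 (f2 z) < z"
    then have le: "z \<le> f1 (f2 z)" by simp
    have "f1 0 \<le> z" using X.feedback_mono[of 0 "f2 K"] f2K f1f2K that by simp
    moreover have nonneg_z: "0 \<le> f2 z" using nf2[of z] that \<open>K > 0\<close> by simp
    ultimately obtain p where p: "p \<ge> 0" "f1 p = z" using feedback_range[OF f1 _ le] by blast
    then have "f2 z < p" using assms(6) that ext_inverse_range[OF f1, of p] by auto
    then show False using feedback_less[OF f1 nonneg_z, of p] p le by simp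
  qed
  \<comment> \<open>The hypothesis on the inverse covers \<open>f1 0 < z\<close>. For smaller
    \<open>z\<close>, strict monotonicity gives \<open>f1 (f2 z) > f1 0 \<ge> z\<close>.\<close>
  have below: "z < f1 (f2 z)" if z: "0 < z" "z < K" for z
  proof (cases "f1 0 < z")
    case True
    then obtain p where p: "p \<ge> 0" "f1 p = z"
      using feedback_range[OF f1, of z "f2 K"] f2K f1f2K z by auto
    then have "p < f2 z" using assms(5) z True ext_inverse_range[OF f1, of p] by auto
    then show ?thesis using feedback_less[OF f1, of p "f2 z"] p by simp
  next
    case False
    have "0 < f2 z" using f2 z by (simp add: feedback_function_def)
    then show ?thesis using feedback_less[OF f1, of 0 "f2 z"] False by simp
  qed
  have lower: "x T \<ge> K \<and> y T \<ge> f2 K" if ini: "\<forall>t\<le>0. \<phi> t \<ge> K \<and> \<psi> t \<ge> f2 K" and "0 \<le> T" for T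
  proof -
    have past: "K \<le> x t" "f2 K \<le> y t" if "t \<le> 0" for t using ini init that by auto
    obtain s where s: "s \<in> {0..T}" "\<And>t. t \<in> {0..T} \<Longrightarrow> x s \<le> x t"
      using continuous_attains_inf[OF compact_Icc _ continuous_on_subset[OF cont(1)], of 0 T] \<open>0 \<le> T\<close> by auto
    \<comment> \<open>The minimum with \<open>K\<close> makes \<open>m\<close> a lower bound for
      \<open>x\<close> on the initial segment too. Positivity of the solution yields
      \<open>0 < m\<close>, which \<open>below\<close> requires.\<close>
    define m where "m = min K (x s)"
    have m: "0 < m" "m \<le> K" using \<open>K > 0\<close> pos[of s] s by (auto simp: m_def)
    have xm: "m \<le> x t" if "t \<le> T" for t
      using past(1)[of t] s(2)[of t] that by (cases "t \<le> 0") (auto simp: m_def)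
    have ym: "f2 m \<le> y t" if "t \<le> T" for t
    proof (cases "t \<le> 0")
      case True
      then show ?thesis using past(2)[of t] Y.feedback_mono[of m K] m by simp
    next
      case False
      show ?thesis
      proof (rule Y.lower_bound)
        show "f2 m \<le> y 0" using m past(2)[of 0] Y.feedback_mono[of m K] by simp
      qed (use that False m xm nonneg in auto)
    qed
    \<comment> \<open>The bound on \<open>y\<close> is fed back into the first equation, up to the
      minimum point \<open>s\<close>. If \<open>m < K\<close>, then \<open>m = x s\<close>, contrary
      to \<open>m < f1 (f2 m)\<close>.\<close>
    have "f1 (f2 m) \<le> x s"
    proof (rule X.lower_bound)
      show "f1 (f2 m) \<le> x 0"
        using past(1)[of 0] X.feedback_mono[of "f2 m" "f2 K"] Y.feedback_mono[of m K] m nf2[of m] f1f2K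
        by simp
    qed (use s m nf2 ym nonneg in auto)
    then have "\<not> m < K" using below[of m] m unfolding m_def by linarith
    then have "m = K" using m by linarith
    then show ?thesis using xm[of T] ym[of T] by simp
  qed
  have upper: "x T \<le> K \<and> y T \<le> f2 K" if ini: "\<forall>t\<le>0. \<phi> t \<le> K \<and> \<psi> t \<le> f2 K" and "0 \<le> T" for T
  proof -
    have past: "x t \<le> K" "y t \<le> f2 K" if "t \<le> 0" for t using ini init that by auto
    obtain s where s: "s \<in> {0..T}" "\<And>t. t \<in> {0..T} \<Longrightarrow> x t \<le> x s"
      using continuous_attains_sup[OF compact_Icc _ continuous_on_subset[OF cont(1)], of 0 T] \<open>0 \<le> T\<close> by auto
    define m where "m = max K (x s)"
    have m: "K \<le> m" by (simp add: m_def)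
    have xm: "x t \<le> m" if "t \<le> T" for t
      using past(1)[of t] s(2)[of t] that by (cases "t \<le> 0") (auto simp: m_def)
    have ym: "y t \<le> f2 m" if "t \<le> T" for t
    proof (cases "t \<le> 0")
      case True
      then show ?thesis using past(2)[of t] Y.feedback_mono[of K m] m \<open>K > 0\<close> by simp
    next
      case False
      show ?thesis
      proof (rule Y.upper_bound)
        show "y 0 \<le> f2 m" using m past(2)[of 0] Y.feedback_mono[of K m] \<open>K > 0\<close> by simp
      qed (use that False xm nonneg in auto)
    qed
    \<comment> \<open>The same feedback at the maximum point: if \<open>K < m\<close>, then
      \<open>m = x s\<close>, contrary to \<open>f1 (f2 m) < m\<close>.\<close>
    have "x s \<le> f1 (f2 m)"
    proof (rule X.upper_bound)
      show "x 0 \<le> f1 (f2 m)"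
        using past(1)[of 0] X.feedback_mono[of "f2 K" "f2 m"] Y.feedback_mono[of K m] m \<open>K > 0\<close> f2K f1f2K
        by simp
    qed (use s m ym nonneg in auto)
    then have "\<not> K < m" using above[of m] unfolding m_def by linarith
    then have "m = K" using m by linarith
    then show ?thesis using xm[of T] ym[of T] \<open>0 \<le> T\<close> by simp
  qed
  from lower upper show ?thesis by blast
qed

end
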